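(* Let $a\in\mathbb{R}$, $0<\nu<1$ and $M\ge 0$. Assume $F:\mathbb{N}_{a+1}\times[0,\infty)\to[0,\infty)$ satisfies a uniform Lipschitz condition with respect to its second variable, i.e., there is a constant $K>0$ such that $|F(t,u)-F(t,v)|\le K|u-v|$ for all $t\in\mathbb{N}_{a+1}$ and $u,v\in[0,\infty)$. Assume $p:\mathbb{N}_a\to(0,\infty)$, and let $(\zeta_M,\|\cdot\|)$ be the complete metric space given by $$\zeta_M:=\{y:\mathbb{N}_{a-1}\to[M,\infty):\ \nabla y(t)\le 0\ \text{ for all } t\in\mathbb{N}_a,\ \text{ and } \nabla y(a)=0\},\qquad \|y\|:=\sup_{t\in\mathbb{N}_{a-1}}|y(t)|.$$ If (H1) the series $\displaystyle\sum_{s=a+1}^{\infty}\frac{1}{p(s)}\sum_{\tau=a+1}^{s}\frac{(s-\rho(\tau))^{\overline{\nu-1}}}{\Gamma(\nu)}F(\tau,y(\rho(\tau)))$ converges for every $y\in\zeta_M$, and (H2) $\displaystyle\beta:=\frac{K}{\Gamma(\nu+1)}\left(\sum_{s=a+1}^{\infty}\frac{(s-a)^{\overline{\nu}}}{p(s)}\right)<1$, then there exists a unique positive solution $y$ of the fractional difference equation $$\nabla_{a-1}^{\nu}(p\nabla y)(t)+F(t,y(\rho(t)))=0,\qquad t\in\mathbb{N}_{a+1},$$ with $\displaystyle\lim_{t\to\infty}y(t)=M$.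
   Context: For a real number $c$, $\mathbb{N}_c:=\{c,c+1,c+2,\dots\}$. The backward jump is $\rho(t):=t-1$, and the nabla difference is $\nabla y(t):=y(t)-y(t-1)$; $(p\nabla y)(t):=p(t)\nabla y(t)$. The generalized rising function is $t^{\overline{r}}:=\Gamma(t+r)/\Gamma(t)$ for $t,t+r\notin\{0,-1,-2,\dots\}$, with the convention $t^{\overline{r}}:=0$ if $t$ is a nonpositive integer but $t+r$ is not. Empty sums are $0$. For $c\in\mathbb{R}$, $\mu>0$ and $g:\mathbb{N}_{c+1}\to\mathbb{R}$, the nabla fractional sum of order $\mu$ based at $c$ is $$\nabla_c^{-\mu}g(t):=\frac{1}{\Gamma(\mu)}\sum_{s=c+1}^{t}(t-\rho(s))^{\overline{\mu-1}}g(s),\qquad t\in\mathbb{N}_c.$$ For $0<\nu<1$, the nabla fractional difference of order $\nu$ based at $c$ is $\nabla_c^{\nu}g(t):=\nabla\big(\nabla_c^{-(1-\nu)}g\big)(t)$, $t\in\mathbb{N}_{c+1}$.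
   Formalization: Uniqueness is claimed among nonnegative solutions with ∇y(a)=0 and limit M (without ∇y(a)=0 it fails, e.g. F=0); strict positivity is claimed unless M=0 and F(t,0)=0 for all t, when the unique solution is y=0. *)

theory Defs
  imports "HOL-Analysis.Analysis"
begin

definition nabla_dom :: "real \<Rightarrow> real set" where
  "nabla_dom c = range (\<lambda>n. c + real n)"

definition rho :: "real \<Rightarrow> real" where
  "rho t = t - 1"

definition nabla :: "(real \<Rightarrow> real) \<Rightarrow> real \<Rightarrow> real" where
  "nabla y t = y t - y (t - 1)"

text \<open>
  Since \<^const>\<open>Gamma\<close> is 0 at the nonpositive integers and division by 0 yields 0, the convention
  that the rising function is 0 when \<open>t\<close> is a nonpositive integer and \<open>t + r\<close> is not holds here.
\<close>
definition rising :: "real \<Rightarrow> real \<Rightarrow> real" where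
  "rising t r = Gamma (t + r) / Gamma t"

definition nabla_sum :: "real \<Rightarrow> real \<Rightarrow> (real \<Rightarrow> real) \<Rightarrow> real \<Rightarrow> real" where
  "nabla_sum c \<mu> g t =
     1 / Gamma \<mu> * (\<Sum>s \<in> {s \<in> nabla_dom (c + 1). s \<le> t}. rising (t - rho s) (\<mu> - 1) * g s)"

definition nabla_fdiff :: "real \<Rightarrow> real \<Rightarrow> (real \<Rightarrow> real) \<Rightarrow> real \<Rightarrow> real" where
  "nabla_fdiff c \<nu> g t = nabla (nabla_sum c (1 - \<nu>) g) t"

text \<open>
  Functions on \<^term>\<open>nabla_dom (a - 1)\<close> are represented by extensional functions on the reals, so that
  equality in \<open>zeta a M\<close> is equality on the domain.
\<close>
definition zeta :: "real \<Rightarrow> real \<Rightarrow> (real \<Rightarrow> real) set" where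
  "zeta a M = {y \<in> nabla_dom (a - 1) \<rightarrow>\<^sub>E {M..}. (\<forall>t \<in> nabla_dom a. nabla y t \<le> 0) \<and> nabla y a = 0}"

definition is_solution ::
  "real \<Rightarrow> real \<Rightarrow> (real \<Rightarrow> real) \<Rightarrow> (real \<Rightarrow> real \<Rightarrow> real) \<Rightarrow> (real \<Rightarrow> real) \<Rightarrow> bool" where
  "is_solution a \<nu> p F y \<longleftrightarrow>
     (\<forall>t \<in> nabla_dom (a + 1).
        nabla_fdiff (a - 1) \<nu> (\<lambda>s. p s * nabla y s) t + F t (y (rho t)) = 0)"

end

theory Submission
  imports Defs
begin

text \<open>
  In generating functions, the nabla fractional sum of order \<open>\<mu>\<close> is multiplication by \<open>(1 - X) powr (-\<mu>)\<close>
  and \<open>D = \<close>\<^const>\<open>nabla\<close> is multiplication by \<open>1 - X\<close>. Since \<open>Dy(a) = 0\<close>, the fractional difference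
  equation can be inverted to \<open>p(t) Dy(t) = - \<close>\<^term>\<open>nabla_sum a \<nu>\<close>\<open> (\<lambda>s. F(s, y(\<rho>(s)))) (t)\<close>, a first-order equation
  with memory for \<open>U n = y(a + n)\<close>. Together with \<open>U n \<rightarrow> M\<close> it becomes, after telescoping, a fixed point
  equation on bounded sequences whose right-hand side is Lipschitz with constant \<open>\<beta>\<close>. A nonnegative solution
  is nonincreasing, hence at least \<open>M\<close>, so uniqueness holds among all nonnegative solutions.
\<close>

section \<open>Contraction argument for a Volterra difference equation\<close>

text \<open>
  The library's \<^class>\<open>complete_space\<close> instance asks for a metric domain, which \<^typ>\<open>nat\<close> is not.
\<close>
lemma complete_UNIV_bcontfun:
  "complete (UNIV :: ('a::topological_space \<Rightarrow>\<^sub>C 'b::complete_space) set)"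
  unfolding complete_def
proof (intro allI impI, elim conjE)
  fix u :: "nat \<Rightarrow> 'a \<Rightarrow>\<^sub>C 'b"
  assume "Cauchy u"
  then have "uniformly_Cauchy_on UNIV (\<lambda>n. apply_bcontfun (u n))"
    unfolding Cauchy_def uniformly_Cauchy_on_def by (meson dist_fun_lt_imp_dist_val_lt)
  then obtain g where "uniform_limit UNIV (\<lambda>n. apply_bcontfun (u n)) g sequentially"
    using Cauchy_uniformly_convergent uniformly_convergent_on_def by blast
  then obtain l where "u \<longlonglongrightarrow> l"
    by (rule uniform_limit_bcontfunE) simp
  then show "\<exists>l\<in>UNIV. u \<longlonglongrightarrow> l" by blast
qed

text \<open>Summing the recursion over all indices from \<open>n\<close> on, with limit
  \<open>M\<close>, writes \<open>U n\<close> as \<open>M\<close> plus a tail of memory terms. In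
  the sup norm this operator is Lipschitz with constant \<open>K\<close> times the total weight, so
  Banach's theorem applies.\<close>

lemma volterra_difference_equation:
  fixes w :: "nat \<Rightarrow> nat \<Rightarrow> real" and f :: "nat \<Rightarrow> real \<Rightarrow> real" and M K :: real
  assumes w_nonneg: "\<And>n k. k \<le> n \<Longrightarrow> 0 \<le> w n k"
    and K: "0 \<le> K"
    and f_nonneg: "\<And>k u. M \<le> u \<Longrightarrow> 0 \<le> f k u"
    and f_lipschitz: "\<And>k u v. M \<le> u \<Longrightarrow> M \<le> v \<Longrightarrow> \<bar>f k u - f k v\<bar> \<le> K * \<bar>u - v\<bar>"
    and summable_w: "summable (\<lambda>n. \<Sum>k\<le>n. w n k)"
    and contraction: "K * (\<Sum>n. \<Sum>k\<le>n. w n k) < 1"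
    and summable_M: "summable (\<lambda>n. \<Sum>k\<le>n. w n k * f k M)"
  shows "\<exists>!U. (\<forall>n. M \<le> U n) \<and> U \<longlonglongrightarrow> M \<and> (\<forall>n. U (Suc n) = U n - (\<Sum>k\<le>n. w n k * f k (U k)))"
proof -
  define W where "W = (\<lambda>n. \<Sum>k\<le>n. w n k)"
  \<comment> \<open>Truncating at \<open>M\<close> makes the operator act on all bounded sequences; its fixed points are
    automatically at least \<open>M\<close>.\<close>
  define L where "L = (\<lambda>U n. \<Sum>k\<le>n. w n k * f k (max M (U k)))"
  \<comment> \<open>\<open>T U n\<close> is \<open>M\<close> plus the tail of \<open>L U\<close>
    from \<open>n\<close>; as total minus partial sum, its limit and its one-step recursion are
    immediate.\<close>
  define T where "T = (\<lambda>U n. M + (suminf (L U) - (\<Sum>i<n. L U i)))"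
  have W_nonneg: "0 \<le> W n" for n
    unfolding W_def by (intro sum_nonneg w_nonneg) auto
  have L_nonneg: "0 \<le> L U n" for U n
    unfolding L_def by (intro sum_nonneg mult_nonneg_nonneg w_nonneg f_nonneg) auto
  have L_diff: "\<bar>L U n - L V n\<bar> \<le> K * d * W n" if d: "\<And>k. \<bar>U k - V k\<bar> \<le> d" for U V d n
  proof -
    have "\<bar>L U n - L V n\<bar> \<le> (\<Sum>k\<le>n. w n k * \<bar>f k (max M (U k)) - f k (max M (V k))\<bar>)"
      unfolding L_def sum_subtractf[symmetric] right_diff_distrib[symmetric]
      by (rule order.trans[OF sum_abs]) (simp add: abs_mult w_nonneg)
    also have "\<dots> \<le> (\<Sum>k\<le>n. w n k * (K * d))"
    proof (intro sum_mono mult_left_mono w_nonneg)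
      fix k
      have "\<bar>f k (max M (U k)) - f k (max M (V k))\<bar> \<le> K * \<bar>max M (U k) - max M (V k)\<bar>"
        by (rule f_lipschitz) auto
      also have "\<dots> \<le> K * d"
        using d[of k] by (intro mult_left_mono K) linarith
      finally show "\<bar>f k (max M (U k)) - f k (max M (V k))\<bar> \<le> K * d" .
    qed auto
    also have "\<dots> = K * d * W n"
      unfolding W_def by (simp add: sum_distrib_left mult_ac)
    finally show ?thesis .
  qed
  \<comment> \<open>Convergence is assumed at the constant sequence \<open>M\<close>; at distance
    \<open>d\<close> from it each memory term changes by at most \<open>K * d * W n\<close>, which
    is summable.\<close>
  have L_summable: "summable (L U)" if "\<And>k. \<bar>U k - M\<bar> \<le> d" for U d
  proof (rule summable_comparison_test')
    show "summable (\<lambda>n. (\<Sum>k\<le>n. w n k * f k M) + K * d * W n)"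
      using summable_w by (intro summable_add summable_M summable_mult) (simp add: W_def)
    fix n
    have "L (\<lambda>_. M) n = (\<Sum>k\<le>n. w n k * f k M)" by (simp add: L_def)
    then show "norm (L U n) \<le> (\<Sum>k\<le>n. w n k * f k M) + K * d * W n"
      using L_diff[of U "\<lambda>_. M" d n, OF that] L_nonneg[of U n] L_nonneg[of "\<lambda>_. M" n] by simp
  qed
  have T_tail: "T U n = M + (\<Sum>i. L U (i + n))" if "summable (L U)" for U n
    unfolding T_def by (simp add: suminf_minus_initial_segment[OF that])
  have T_lim: "T U \<longlonglongrightarrow> M" if "summable (L U)" for U
  proof -
    have "T U \<longlonglongrightarrow> M + (suminf (L U) - suminf (L U))"
      unfolding T_def by (intro tendsto_intros summable_LIMSEQ that)
    then show ?thesis by simp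
  qed
  have T_diff: "\<bar>T U n - T V n\<bar> \<le> K * suminf W * d"
    if d: "\<And>k. \<bar>U k - V k\<bar> \<le> d" and U: "summable (L U)" and V: "summable (L V)" for U V d n
  proof -
    have sW: "summable W" using summable_w by (simp add: W_def)
    have d0: "0 \<le> d" using d[of 0] by linarith
    have "T U n - T V n = (\<Sum>i. L U (i + n) - L V (i + n))"
      using suminf_diff[OF summable_ignore_initial_segment[OF U, of n] summable_ignore_initial_segment[OF V, of n]]
      by (simp add: T_tail U V)
    also have "\<bar>\<dots>\<bar> \<le> (\<Sum>i. K * d * W (i + n))"
      using norm_suminf_le[of "\<lambda>i. L U (i + n) - L V (i + n)" "\<lambda>i. K * d * W (i + n)"] L_diff[OF d]
        summable_ignore_initial_segment[OF sW, of n] by (simp add: summable_mult)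
    also have "\<dots> = K * d * (suminf W - sum W {..<n})"
      using suminf_minus_initial_segment[OF sW, of n]
      by (simp add: suminf_mult sW)
    also have "\<dots> \<le> K * d * suminf W"
      using d0 K by (intro mult_left_mono) (auto intro: sum_nonneg W_nonneg)
    finally show ?thesis by (simp add: mult_ac)
  qed
  \<comment> \<open>Every sequence is continuous for the discrete topology of the naturals, so
    boundedness suffices. On bounded sequences \<open>T\<close> produces convergent ones, so it
    stays in the space.\<close>
  have bcontfun_if_lim: "U \<in> bcontfun" if "U \<longlonglongrightarrow> M" for U :: "nat \<Rightarrow> real"
    using convergent_imp_bounded[OF that] by (simp add: bcontfun_def)
  have bounded_dist: "\<exists>d. \<forall>k. \<bar>apply_bcontfun u k - M\<bar> \<le> d" for u :: "nat \<Rightarrow>\<^sub>C real"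
    using dist_bounded[of u _ "const_bcontfun M"] by (auto simp: dist_real_def)
  have u_summable: "summable (L (apply_bcontfun u))" for u
    using bounded_dist[of u] L_summable by blast
  define \<Phi> :: "(nat \<Rightarrow>\<^sub>C real) \<Rightarrow> (nat \<Rightarrow>\<^sub>C real)" where "\<Phi> = (\<lambda>u. Bcontfun (T (apply_bcontfun u)))"
  have \<Phi>_apply: "apply_bcontfun (\<Phi> u) = T (apply_bcontfun u)" for u
    unfolding \<Phi>_def by (intro Bcontfun_inverse bcontfun_if_lim T_lim u_summable)
  have "\<exists>!u\<in>UNIV. \<Phi> u = u"
  proof (rule Banach_fix[OF complete_UNIV_bcontfun UNIV_not_empty, of "K * suminf W"])
    have "0 \<le> suminf W"
      using summable_w by (intro suminf_nonneg W_nonneg) (simp add: W_def)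
    then show "0 \<le> K * suminf W" using K by simp
    show "K * suminf W < 1" using contraction by (simp add: W_def)
    fix u v :: "nat \<Rightarrow>\<^sub>C real"
    have "\<bar>apply_bcontfun u k - apply_bcontfun v k\<bar> \<le> dist u v" for k
      using dist_bounded[of u k v] by (simp add: dist_real_def)
    then show "dist (\<Phi> u) (\<Phi> v) \<le> K * suminf W * dist u v"
      by (intro dist_bound) (simp add: \<Phi>_apply dist_real_def T_diff u_summable)
  qed auto
  moreover have "\<Phi> u = u \<longleftrightarrow> T (apply_bcontfun u) = apply_bcontfun u" for u
    by (metis \<Phi>_apply apply_bcontfun_inject)
  ultimately obtain u where u: "T (apply_bcontfun u) = apply_bcontfun u"
    and u_unique: "\<And>v. T (apply_bcontfun v) = apply_bcontfun v \<Longrightarrow> v = u"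
    by auto
  define U where "U = apply_bcontfun u"
  have TU: "T U = U" using u by (simp add: U_def)
  have sU: "summable (L U)" using u_summable by (simp add: U_def)
  have U_ge: "M \<le> U n" for n
    using fun_cong[OF TU, of n] T_tail[OF sU, of n] L_nonneg
      suminf_nonneg[OF summable_ignore_initial_segment[OF sU, of n]] by force
  show ?thesis
  proof (rule ex1I[of _ U], intro conjI allI)
    show "M \<le> U n" for n by (rule U_ge)
    show "U \<longlonglongrightarrow> M" using T_lim[OF sU] TU by simp
    fix n
    have "T U (Suc n) = T U n - L U n" by (simp add: T_def)
    then show "U (Suc n) = U n - (\<Sum>k\<le>n. w n k * f k (U k))"
      using U_ge by (simp add: TU L_def max_absorb2)
  next
    fix V assume V: "(\<forall>n. M \<le> V n) \<and> V \<longlonglongrightarrow> M \<and> (\<forall>n. V (Suc n) = V n - (\<Sum>k\<le>n. w n k * f k (V k)))"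
    \<comment> \<open>The memory terms of a solution are its successive drops; they telescope to
      \<open>V 0 - M\<close>, so a solution is a fixed point of \<open>T\<close>.\<close>
    then have step: "L V n = V n - V (Suc n)" for n
      by (simp add: L_def max_absorb2)
    have "L V sums (V 0 - M)"
      using telescope_sums'[of V M] V unfolding step[abs_def] by simp
    then have "T V n = V n" for n
      using sum_lessThan_telescope'[of V n] unfolding T_def by (simp add: sums_iff step)
    then have "T V = V" by auto
    moreover have "apply_bcontfun (Bcontfun V) = V"
      using V by (intro Bcontfun_inverse bcontfun_if_lim) auto
    ultimately show "V = U" using u_unique[of "Bcontfun V"] by (metis U_def)
  qed
qed

section \<open>Binomial series and their coefficients\<close>

text \<open>The expansion of \<open>(1 - X) powr (-\<mu>)\<close>.\<close>
definition rising_fps :: "real \<Rightarrow> real fps" where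
  "rising_fps \<mu> = Abs_fps (\<lambda>n. pochhammer \<mu> n / fact n)"

text \<open>Vandermonde's identity for Pochhammer symbols; through it, orders of summation and
  differencing add under multiplication.\<close>

lemma rising_fps_add: "rising_fps (\<mu> + \<nu>) = rising_fps \<mu> * rising_fps \<nu>"
proof (rule fps_ext)
  fix n
  have "pochhammer (\<mu> + \<nu>) n / fact n =
      (\<Sum>k\<le>n. real (n choose k) * pochhammer \<mu> k * pochhammer \<nu> (n - k) / fact n)"
    by (simp add: pochhammer_binomial_sum sum_divide_distrib)
  also have "\<dots> = (\<Sum>k\<le>n. pochhammer \<mu> k / fact k * (pochhammer \<nu> (n - k) / fact (n - k)))"
    by (intro sum.cong refl) (simp add: binomial_fact)
  finally show "fps_nth (rising_fps (\<mu> + \<nu>)) n = fps_nth (rising_fps \<mu> * rising_fps \<nu>) n"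
    by (simp add: rising_fps_def fps_mult_nth atMost_atLeast0)
qed

lemma rising_fps_0: "rising_fps 0 = 1"
  by (rule fps_ext) (simp add: rising_fps_def pochhammer_0_left)

lemma rising_fps_neg_1: "rising_fps (-1) = 1 - fps_X"
proof (rule fps_ext)
  fix n
  show "fps_nth (rising_fps (-1)) n = fps_nth (1 - fps_X) n"
    \<comment> \<open>\<open>pochhammer (-1) n\<close> vanishes once \<open>n\<close> exceeds 1, so
      the series stops after the linear term.\<close>
    using pochhammer_of_nat_eq_0_lemma[of 1 n, where 'a = real]
    by (cases "n \<le> 1") (auto simp: rising_fps_def le_Suc_eq)
qed

text \<open>Identifies the coefficients with the kernel of \<open>nabla_sum\<close>: the argument is
  \<open>n + 1\<close> because \<open>t - rho s = t - s + 1\<close>.\<close>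

lemma rising_fps_nth:
  assumes "0 < \<mu>"
  shows "fps_nth (rising_fps \<mu>) n = rising (real n + 1) (\<mu> - 1) / Gamma \<mu>"
proof -
  have "\<mu> \<notin> \<int>\<^sub>\<le>\<^sub>0"
    using assms nonpos_Ints_nonpos[of \<mu>] by auto
  then show ?thesis
    by (simp add: rising_fps_def rising_def pochhammer_Gamma Gamma_fact[symmetric] add_ac)
qed

lemma rising_fps_nth_pos: "0 < \<mu> \<Longrightarrow> 0 < fps_nth (rising_fps \<mu>) n"
  by (simp add: rising_fps_def pochhammer_pos)

text \<open>\<open>rising_fps 1\<close> is the geometric series, so multiplying by it takes partial
  sums and raises the order by one.\<close>

lemma sum_rising_fps: "(\<Sum>k\<le>n. fps_nth (rising_fps \<mu>) (n - k)) = fps_nth (rising_fps (\<mu> + 1)) n"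
proof -
  have "fps_nth (rising_fps 1) k = 1" for k
    by (simp add: rising_fps_def pochhammer_fact[symmetric])
  then show ?thesis
    unfolding rising_fps_add[of 1 \<mu>, unfolded add.commute[of 1]]
    by (simp add: fps_mult_nth atMost_atLeast0)
qed

section \<open>Nabla operators as power series multiplication\<close>

lemma nabla_dom_iff: "t \<in> nabla_dom c \<longleftrightarrow> (\<exists>n. t = c + real n)"
  by (auto simp: nabla_dom_def)

lemma ball_nabla_dom: "(\<forall>t \<in> nabla_dom c. P t) \<longleftrightarrow> (\<forall>n. P (c + real n))"
  by (auto simp: nabla_dom_def)

lemma sum_nabla_dom:
  "(\<Sum>s \<in> {s \<in> nabla_dom c. s \<le> c + real n}. g s) = (\<Sum>k\<le>n. g (c + real k))"
proof -
  have "{s \<in> nabla_dom c. s \<le> c + real n} = (\<lambda>k. c + real k) ` {..n}"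
    by (auto simp: nabla_dom_def)
  then show ?thesis
    by (simp add: sum.reindex inj_on_def)
qed

lemma nabla_sum_eq_sum:
  assumes "0 < \<mu>"
  shows "nabla_sum c \<mu> g (c + 1 + real n) =
      (\<Sum>k\<le>n. fps_nth (rising_fps \<mu>) (n - k) * g (c + 1 + real k))"
proof -
  have "rising (c + 1 + real n - rho (c + 1 + real k)) (\<mu> - 1) =
      Gamma \<mu> * fps_nth (rising_fps \<mu>) (n - k)" if "k \<le> n" for k
    using assms that less_imp_neq[OF Gamma_real_pos[OF assms]]
    by (simp add: rising_fps_nth rho_def of_nat_diff algebra_simps)
  then show ?thesis
    using Gamma_real_pos[OF assms] unfolding nabla_sum_def sum_nabla_dom
    by (simp add: sum_distrib_left)
qed

text \<open>The kernel depends only on \<open>n - k\<close>, so the fractional sum is a Cauchy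
  product.\<close>

lemma nabla_sum_eq_fps_nth:
  assumes "0 < \<mu>"
  shows "nabla_sum c \<mu> g (c + 1 + real n) =
      fps_nth (rising_fps \<mu> * Abs_fps (\<lambda>k. g (c + 1 + real k))) n"
  unfolding nabla_sum_eq_sum[OF assms] mult.commute[of "rising_fps \<mu>"] fps_mult_nth
  by (simp add: atMost_atLeast0 mult.commute)

text \<open>Fractional differencing multiplies by \<open>rising_fps (- \<nu>)\<close>, whose inverse
  is \<open>rising_fps \<nu>\<close>. The difference is based at \<open>a - 1\<close> but the sum at
  \<open>a\<close>; \<open>g a = 0\<close> reconciles the two.\<close>

lemma nabla_fdiff_eq_iff:
  assumes nu: "0 < \<nu>" "\<nu> < 1" and g: "g a = 0"
  shows "(\<forall>t \<in> nabla_dom (a + 1). nabla_fdiff (a - 1) \<nu> g t = h t) \<longleftrightarrow>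
    (\<forall>n. g (a + 1 + real n) = nabla_sum a \<nu> h (a + 1 + real n))"
proof -
  define G where "G = Abs_fps (\<lambda>n. g (a + 1 + real n))"
  define H where "H = Abs_fps (\<lambda>n. h (a + 1 + real n))"
  \<comment> \<open>The series starting at \<open>a\<close> has constant term
    \<open>g a = 0\<close>, so a factor \<open>fps_X\<close> splits off.\<close>
  have G_shift: "Abs_fps (\<lambda>n. g (a + real n)) = fps_X * G"
  proof (rule fps_ext)
    show "fps_nth (Abs_fps (\<lambda>n. g (a + real n))) n = fps_nth (fps_X * G) n" for n
      by (cases n) (simp_all add: G_def g add_ac)
  qed
  have sum: "nabla_sum (a - 1) (1 - \<nu>) g (a + real n) = fps_nth (rising_fps (1 - \<nu>) * (fps_X * G)) n" for n
    using nabla_sum_eq_fps_nth[of "1 - \<nu>" "a - 1" g n] nu by (simp add: G_shift)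
  have fdiff: "nabla_fdiff (a - 1) \<nu> g (a + 1 + real n) = fps_nth (rising_fps (- \<nu>) * G) n" for n
  proof -
    have "nabla_fdiff (a - 1) \<nu> g (a + 1 + real n) =
        nabla_sum (a - 1) (1 - \<nu>) g (a + real (Suc n)) - nabla_sum (a - 1) (1 - \<nu>) g (a + real n)"
      by (simp add: nabla_fdiff_def nabla_def add_ac)
    \<comment> \<open>The difference is the coefficient at \<open>Suc n\<close> of the product with
      \<open>1 - fps_X\<close>; the orders \<open>-1\<close> and \<open>1 - \<nu>\<close> combine,
      and the factor \<open>fps_X\<close> returns the index to \<open>n\<close>.\<close>
    also have "\<dots> = fps_nth ((1 - fps_X) * (rising_fps (1 - \<nu>) * (fps_X * G))) (Suc n)"
      unfolding sum by (simp add: left_diff_distrib)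
    also have "(1 - fps_X) * (rising_fps (1 - \<nu>) * (fps_X * G)) = fps_X * (rising_fps (- \<nu>) * G)"
      using rising_fps_add[of "-1" "1 - \<nu>"] by (simp add: rising_fps_neg_1 mult_ac)
    finally show ?thesis by simp
  qed
  have inverse: "rising_fps (- \<nu>) * rising_fps \<nu> = 1"
    by (simp add: rising_fps_add[symmetric] rising_fps_0)
  have "(\<forall>t \<in> nabla_dom (a + 1). nabla_fdiff (a - 1) \<nu> g t = h t) \<longleftrightarrow> rising_fps (- \<nu>) * G = H"
    by (simp add: ball_nabla_dom fdiff fps_eq_iff H_def)
  also have "\<dots> \<longleftrightarrow> G = rising_fps \<nu> * H"
  proof
    assume "rising_fps (- \<nu>) * G = H"
    then have "rising_fps \<nu> * H = rising_fps (- \<nu>) * rising_fps \<nu> * G"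
      by (auto simp: mult_ac)
    then show "G = rising_fps \<nu> * H" by (simp add: inverse)
  next
    assume "G = rising_fps \<nu> * H"
    then have "rising_fps (- \<nu>) * G = rising_fps (- \<nu>) * rising_fps \<nu> * H"
      by (simp add: mult.assoc)
    then show "rising_fps (- \<nu>) * G = H" by (simp add: inverse)
  qed
  also have "\<dots> \<longleftrightarrow> (\<forall>n. g (a + 1 + real n) = nabla_sum a \<nu> h (a + 1 + real n))"
    using nabla_sum_eq_fps_nth[OF nu(1), of a h] by (auto simp: fps_eq_iff G_def H_def)
  finally show ?thesis .
qed

text \<open>\<open>nabla y a = 0\<close> makes \<open>p s * nabla y s\<close> vanish at
  \<open>a\<close>, so the inversion applies; dividing by the positive \<open>p\<close> leaves a
  recursion with memory.\<close>

lemma is_solution_iff: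
  assumes nu: "0 < \<nu>" "\<nu> < 1" and p_pos: "\<And>t. t \<in> nabla_dom a \<Longrightarrow> 0 < p t" and y: "nabla y a = 0"
  shows "is_solution a \<nu> p F y \<longleftrightarrow>
    (\<forall>n. y (a + real (Suc n)) = y (a + real n) -
      (\<Sum>k\<le>n. fps_nth (rising_fps \<nu>) (n - k) / p (a + 1 + real n) * F (a + 1 + real k) (y (a + real k))))"
    (is "_ \<longleftrightarrow> (\<forall>n. _ = _ - ?L n)")
proof -
  let ?h = "\<lambda>t. - F t (y (rho t))"
  have "is_solution a \<nu> p F y \<longleftrightarrow>
      (\<forall>t \<in> nabla_dom (a + 1). nabla_fdiff (a - 1) \<nu> (\<lambda>s. p s * nabla y s) t = ?h t)"
    by (simp add: is_solution_def eq_neg_iff_add_eq_0)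
  also have "\<dots> \<longleftrightarrow> (\<forall>n. p (a + 1 + real n) * nabla y (a + 1 + real n) = nabla_sum a \<nu> ?h (a + 1 + real n))"
    by (rule nabla_fdiff_eq_iff[OF nu]) (simp add: y)
  also have "\<dots> \<longleftrightarrow> (\<forall>n. y (a + real (Suc n)) = y (a + real n) - ?L n)"
  proof (rule all_cong1)
    fix n
    have "0 < p (a + 1 + real n)"
      by (rule p_pos) (auto simp: nabla_dom_iff intro: exI[of _ "Suc n"])
    moreover have "rho (a + 1 + real k) = a + real k" for k
      by (simp add: rho_def)
    then have "nabla_sum a \<nu> ?h (a + 1 + real n) = - (p (a + 1 + real n) * ?L n)"
      using \<open>0 < p (a + 1 + real n)\<close>
      by (simp add: nabla_sum_eq_sum nu sum_distrib_left sum_negf[symmetric] del: sum_negf)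
    moreover have "nabla y (a + 1 + real n) = y (a + real (Suc n)) - y (a + real n)"
      by (simp add: nabla_def add_ac)
    ultimately show "p (a + 1 + real n) * nabla y (a + 1 + real n) = nabla_sum a \<nu> ?h (a + 1 + real n) \<longleftrightarrow>
        y (a + real (Suc n)) = y (a + real n) - ?L n"
      using mult_left_cancel[of "p (a + 1 + real n)" "y (a + real (Suc n)) - y (a + real n)" "- ?L n"]
      by auto
  qed
  finally show ?thesis .
qed

section \<open>Existence, positivity and uniqueness of the solution\<close>

theorem theorem2p1:
  fixes a \<nu> M K :: real
    and F :: "real \<Rightarrow> real \<Rightarrow> real"
    and p :: "real \<Rightarrow> real"
  assumes nu: "0 < \<nu>" "\<nu> < 1"
    and M: "0 \<le> M"
    and F_nonneg: "\<And>t u. t \<in> nabla_dom (a + 1) \<Longrightarrow> 0 \<le> u \<Longrightarrow> 0 \<le> F t u"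
    and K: "0 < K"
    and F_lipschitz: "\<And>t u v. t \<in> nabla_dom (a + 1) \<Longrightarrow> 0 \<le> u \<Longrightarrow> 0 \<le> v \<Longrightarrow>
           \<bar>F t u - F t v\<bar> \<le> K * \<bar>u - v\<bar>"
    and p_pos: "\<And>t. t \<in> nabla_dom a \<Longrightarrow> 0 < p t"
    and H1: "\<And>y. y \<in> zeta a M \<Longrightarrow>
           summable (\<lambda>n. let s = a + 1 + real n in
             1 / p s * (\<Sum>\<tau> \<in> {\<tau> \<in> nabla_dom (a + 1). \<tau> \<le> s}.
               rising (s - rho \<tau>) (\<nu> - 1) / Gamma \<nu> * F \<tau> (y (rho \<tau>))))"
    and H2_conv: "summable (\<lambda>n. let s = a + 1 + real n in rising (s - a) \<nu> / p s)"
    and H2: "K / Gamma (\<nu> + 1) *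
           (\<Sum>n. let s = a + 1 + real n in rising (s - a) \<nu> / p s) < 1"
  shows "\<exists>y \<in> zeta a M.
           is_solution a \<nu> p F y
         \<and> (\<lambda>n. y (a - 1 + real n)) \<longlonglongrightarrow> M
         \<and> (0 < M \<or> (\<exists>t \<in> nabla_dom (a + 1). F t 0 \<noteq> 0)
              \<longrightarrow> (\<forall>t \<in> nabla_dom (a - 1). 0 < y t))
         \<and> (\<forall>z \<in> nabla_dom (a - 1) \<rightarrow>\<^sub>E {0..}.
              nabla z a = 0 \<and> is_solution a \<nu> p F z \<and> (\<lambda>n. z (a - 1 + real n)) \<longlonglongrightarrow> M
              \<longrightarrow> z = y)"
proof -
  \<comment> \<open>\<open>w n k\<close> divides the kernel by \<open>p\<close> at the outer point.
    \<open>f k\<close> samples \<open>F\<close> at \<open>a + 1 + k\<close>, but because of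
    \<open>rho\<close> it is applied to \<open>y (a + k)\<close>.\<close>
  define w where "w n k = fps_nth (rising_fps \<nu>) (n - k) / p (a + 1 + real n)" for n k
  define f where "f k = F (a + 1 + real k)" for k :: nat
  have mem_dom: "a + 1 + real n \<in> nabla_dom (a + 1)" "a + 1 + real n \<in> nabla_dom a"
    "a + real n \<in> nabla_dom a" "a + real n \<in> nabla_dom (a - 1)" "a - 1 \<in> nabla_dom (a - 1)" for n
    by (auto simp: nabla_dom_iff intro: exI[of _ n] exI[of _ "Suc n"] exI[of _ 0])
  have dom_cases: "t = a - 1 \<or> (\<exists>n. t = a + real n)" if t: "t \<in> nabla_dom (a - 1)" for t
  proof -
    obtain n where "t = a - 1 + real n" using t by (auto simp: nabla_dom_iff)
    then show ?thesis by (cases n) auto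
  qed
  have p_pos': "0 < p (a + 1 + real n)" for n
    by (intro p_pos mem_dom)
  have w_pos: "0 < w n k" for n k
    using nu p_pos' by (simp add: w_def rising_fps_nth_pos)
  have f_nonneg: "0 \<le> f k u" if "0 \<le> u" for k u
    unfolding f_def by (intro F_nonneg mem_dom that)
  have is_solution_iff': "is_solution a \<nu> p F y \<longleftrightarrow>
      (\<forall>n. y (a + real (Suc n)) = y (a + real n) - (\<Sum>k\<le>n. w n k * f k (y (a + real k))))"
    if "nabla y a = 0" for y
    using is_solution_iff[of \<nu> a p y F] nu p_pos that by (simp add: w_def f_def)
  \<comment> \<open>Row sums raise the order from \<open>\<nu>\<close> to \<open>\<nu> + 1\<close>,
    so \<open>K\<close> times their total is the constant of (H2).\<close>
  have w_sum: "(\<Sum>k\<le>n. w n k) = (let s = a + 1 + real n in rising (s - a) \<nu> / p s) / Gamma (\<nu> + 1)" for n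
  proof -
    have "(\<Sum>k\<le>n. w n k) = fps_nth (rising_fps (\<nu> + 1)) n / p (a + 1 + real n)"
      by (simp add: w_def sum_divide_distrib[symmetric] sum_rising_fps)
    then show ?thesis
      using nu by (simp add: rising_fps_nth Let_def add_ac)
  qed
  have "\<exists>!U. (\<forall>n. M \<le> U n) \<and> U \<longlonglongrightarrow> M \<and> (\<forall>n. U (Suc n) = U n - (\<Sum>k\<le>n. w n k * f k (U k)))"
  proof (rule volterra_difference_equation)
    show "0 \<le> w n k" for n k by (rule less_imp_le[OF w_pos])
    show "0 \<le> K" using K by simp
    show "0 \<le> f k u" if "M \<le> u" for k u using f_nonneg M that by simp
    show "\<bar>f k u - f k v\<bar> \<le> K * \<bar>u - v\<bar>" if "M \<le> u" "M \<le> v" for k u v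
      unfolding f_def using M that by (intro F_lipschitz mem_dom) auto
    show "summable (\<lambda>n. \<Sum>k\<le>n. w n k)"
      unfolding w_sum by (intro summable_divide H2_conv)
    show "K * (\<Sum>n. \<Sum>k\<le>n. w n k) < 1"
      using H2 unfolding w_sum suminf_divide[OF H2_conv] by simp
    \<comment> \<open>The constant \<open>M\<close>, made extensional, lies in
      \<open>zeta a M\<close>; (H1) at this function gives the summability required at
      \<open>M\<close>.\<close>
    define c where "c = restrict (\<lambda>_. M) (nabla_dom (a - 1))"
    have c_simps: "c (a + real n) = M" "c (a - 1) = M" for n
      by (simp_all add: c_def mem_dom)
    have c_nabla: "nabla c (a + real n) = 0" for n
      using c_simps(1)[of n] c_simps(1)[of "n - 1"] c_simps(2)
      by (cases n) (simp_all add: nabla_def)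
    then have "c \<in> zeta a M"
      using c_nabla[of 0] c_nabla by (auto simp: zeta_def ball_nabla_dom) (auto simp: c_def)
    have "(let s = a + 1 + real n in 1 / p s * (\<Sum>\<tau> \<in> {\<tau> \<in> nabla_dom (a + 1). \<tau> \<le> s}.
        rising (s - rho \<tau>) (\<nu> - 1) / Gamma \<nu> * F \<tau> (c (rho \<tau>)))) =
        1 / p (a + 1 + real n) * nabla_sum a \<nu> (\<lambda>t. F t (c (rho t))) (a + 1 + real n)" for n
      by (simp add: nabla_sum_def sum_distrib_left Let_def)
    also have "\<dots> n = (\<Sum>k\<le>n. w n k * f k M)" for n
      using c_simps(1) nu
      by (simp add: nabla_sum_eq_sum rho_def w_def f_def sum_divide_distrib)
    finally show "summable (\<lambda>n. \<Sum>k\<le>n. w n k * f k M)"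
      using H1[OF \<open>c \<in> zeta a M\<close>] by simp
  qed
  then obtain U where U_ge: "\<And>n. M \<le> U n" and U_lim: "U \<longlonglongrightarrow> M"
    and U_Suc: "\<And>n. U (Suc n) = U n - (\<Sum>k\<le>n. w n k * f k (U k))"
    and U_unique: "\<And>V. \<forall>n. M \<le> V n \<Longrightarrow> V \<longlonglongrightarrow> M \<Longrightarrow>
      \<forall>n. V (Suc n) = V n - (\<Sum>k\<le>n. w n k * f k (V k)) \<Longrightarrow> V = U"
    by (elim ex1E) blast
  have U_nonneg: "0 \<le> U n" for n
    using M U_ge[of n] by linarith
  have wf_nonneg: "0 \<le> (\<Sum>k\<le>n. w n k * f k (V k))" if "\<And>k. 0 \<le> V k" for V n
    by (intro sum_nonneg mult_nonneg_nonneg f_nonneg that less_imp_le[OF w_pos])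
  have U_decseq: "decseq U"
    using wf_nonneg[of U, OF U_nonneg] by (intro decseq_SucI) (simp add: U_Suc)

  \<comment> \<open>The floor recovers \<open>n\<close> from \<open>t = a + n\<close>. At
    \<open>a - 1\<close> it is -1, which \<open>nat\<close> sends to 0; hence
    \<open>y (a - 1) = y a\<close>, the condition \<open>nabla y a = 0\<close>.\<close>
  define y where "y = restrict (\<lambda>t. U (nat \<lfloor>t - a\<rfloor>)) (nabla_dom (a - 1))"
  have y_simps: "y (a + real n) = U n" "y (a - 1) = U 0" for n
    by (simp_all add: y_def mem_dom)
  have nabla_y: "nabla y a = 0"
    using y_simps(1)[of 0] by (simp add: nabla_def y_simps)
  have nabla_y_le: "nabla y (a + real n) \<le> 0" for n
  proof (cases n)
    case (Suc m)
    then have "nabla y (a + real n) = U (Suc m) - U m"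
      using y_simps(1)[of "Suc m"] y_simps(1)[of m] by (simp add: nabla_def)
    then show ?thesis using U_decseq by (simp add: decseq_Suc_iff)
  qed (simp add: nabla_y)
  have y_zeta: "y \<in> zeta a M"
    using nabla_y nabla_y_le U_ge by (auto simp: zeta_def nabla_dom_iff y_def)
  have y_solution: "is_solution a \<nu> p F y"
    unfolding is_solution_iff'[OF nabla_y] y_simps using U_Suc by blast
  have shift: "a - 1 + real (Suc n) = a + real n" for n by simp
  have y_lim: "(\<lambda>n. y (a - 1 + real n)) \<longlonglongrightarrow> M"
    by (subst filterlim_sequentially_Suc[symmetric]) (simp only: shift y_simps U_lim)

  \<comment> \<open>If \<open>M = 0\<close> and \<open>F t 0\<close> vanishes on the whole domain,
    the zero function is the solution, so this case has to be excluded.\<close>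
  have U_pos: "0 < U n" if nontrivial: "0 < M \<or> (\<exists>t \<in> nabla_dom (a + 1). F t 0 \<noteq> 0)" for n
  proof (rule ccontr)
    assume "\<not> 0 < U n"
    then have U_n: "U n = 0" and "M = 0"
      using U_nonneg[of n] U_ge[of n] M by linarith+
    then obtain k0 where k0: "f k0 0 \<noteq> 0"
      using nontrivial by (auto simp: nabla_dom_iff f_def)
    have U_eq_0: "U m = 0" if "n \<le> m" for m
      using decseqD[OF U_decseq that] U_nonneg[of m] U_n by linarith
    have f_eq_0: "f k (U k) = 0" for k
    proof -
      \<comment> \<open>Beyond \<open>n\<close> the sequence stays 0, so the memory sum at
        \<open>m\<close> is 0; as \<open>k \<le> m\<close> and all weights are positive, its
        \<open>k\<close>-th term vanishes too.\<close>
      define m where "m = max n k"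
      have "(\<Sum>k\<le>m. w m k * f k (U k)) = 0"
        using U_Suc[of m] U_eq_0[of m] U_eq_0[of "Suc m"] by (simp add: m_def)
      then have "\<forall>k\<in>{..m}. w m k * f k (U k) = 0"
        by (subst (asm) sum_nonneg_eq_0_iff)
          (auto intro!: mult_nonneg_nonneg f_nonneg U_nonneg less_imp_le[OF w_pos])
      then show ?thesis
        using w_pos[of m k] by (force simp: m_def)
    qed
    \<comment> \<open>Without memory terms \<open>U\<close> is constant, hence 0 everywhere, which
      contradicts \<open>f k0 0 \<noteq> 0\<close>.\<close>
    have "U k = U 0" for k
      by (induction k) (simp_all add: U_Suc f_eq_0)
    then show False
      using k0 f_eq_0[of k0] U_n by metis
  qed

  have "z = y" if z: "z \<in> nabla_dom (a - 1) \<rightarrow>\<^sub>E {0..}" "nabla z a = 0" "is_solution a \<nu> p F z"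
    "(\<lambda>n. z (a - 1 + real n)) \<longlonglongrightarrow> M" for z
  proof -
    define V where "V n = z (a + real n)" for n
    have V_nonneg: "0 \<le> V n" for n
      using z(1) mem_dom(4)[of n] by (auto simp: V_def)
    have V_Suc: "\<forall>n. V (Suc n) = V n - (\<Sum>k\<le>n. w n k * f k (V k))"
      using z(3) unfolding is_solution_iff'[OF z(2)] V_def .
    have V_lim: "V \<longlonglongrightarrow> M"
      using filterlim_sequentially_Suc[THEN iffD2, OF z(4)] unfolding shift V_def[abs_def] .
    have "decseq V"
      using wf_nonneg[of V, OF V_nonneg] V_Suc by (intro decseq_SucI) simp
    then have "V = U"
      using V_lim V_Suc by (intro U_unique) (auto intro: decseq_ge)
    then have eq: "z (a + real n) = y (a + real n)" for n
      by (simp add: y_simps V_def fun_eq_iff)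
    \<comment> \<open>The recursion starts at \<open>a\<close>; the value at \<open>a - 1\<close> is
      fixed by \<open>nabla z a = 0\<close>.\<close>
    moreover have "z (a - 1) = y (a - 1)"
      using eq[of 0] z(2) nabla_y by (simp add: nabla_def)
    ultimately have "z t = y t" if "t \<in> nabla_dom (a - 1)" for t
      using dom_cases[OF that] by auto
    then show "z = y"
      using z(1) y_zeta by (intro PiE_ext[of z _ _ y]) (auto simp: zeta_def PiE_iff)
  qed
  moreover have "0 < y t" if "0 < M \<or> (\<exists>t \<in> nabla_dom (a + 1). F t 0 \<noteq> 0)" "t \<in> nabla_dom (a - 1)" for t
    using dom_cases[OF that(2)] U_pos[OF that(1)] by (auto simp: y_simps)
  ultimately show ?thesis
    using y_zeta y_solution y_lim by blast
qed

end
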